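(* Let $T,T'\colon\mathcal{A}\times\mathcal{B}\to\mathcal{C}$ and $H,H'\colon\mathcal{A}^{\mathrm{op}}\times\mathcal{C}\to\mathcal{B}$ be functors forming left-sided adjunctions of two variables $T\dashv_{\mathrm{L}}H$ (counit $\epsilon$, unit $\eta$) and $T'\dashv_{\mathrm{L}}H'$ (counit $\epsilon'$, unit $\eta'$), and let $\theta\colon T\Rightarrow T'$ be a natural transformation. Then $\theta$ has an inverse $\theta^{-1}\colon T'\Rightarrow T$ if and only if its conjugate $j_{\mathrm{l}}(\theta)\colon H'\Rightarrow H$ has an inverse, and in that case the inverse of $j_{\mathrm{l}}(\theta)$ is $j_{\mathrm{l}}(\theta^{-1})\colon H\Rightarrow H'$.
   Context: A left-sided adjunction of two variables $T\dashv_{\mathrm{L}}H$ consists of functors $T\colon\mathcal{A}\times\mathcal{B}\to\mathcal{C}$ and $H\colon\mathcal{A}^{\mathrm{op}}\times\mathcal{C}\to\mathcal{B}$ and families of morphisms $\epsilon_{a,c}\colon T(a,H(a,c))\to c$ (counit) and $\eta_{a,b}\colon b\to H(a,T(a,b))$ (unit) such that: $\epsilon_{a,c}$ is natural in $c$ and $\eta_{a,b}$ is natural in $b$; they are extranatural in $a$, meaning that for every $f\colon a\to a'$ in $\mathcal{A}$, $\epsilon_{a,c}\circ T(a,H(f,c))=\epsilon_{a',c}\circ T(f,H(a',c))$ and $H(f,T(a',b))\circ\eta_{a',b}=H(a,T(f,b))\circ\eta_{a,b}$; and the triangle identities $H(a,\epsilon_{a,c})\circ\eta_{a,H(a,c)}=\mathrm{id}_{H(a,c)}$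 and $\epsilon_{a,T(a,b)}\circ T(a,\eta_{a,b})=\mathrm{id}_{T(a,b)}$ hold. Conjugation: for $\theta\colon T\Rightarrow T'$, the conjugate $j_{\mathrm{l}}(\theta)\colon H'\Rightarrow H$ has components $$H'(a,c)\xrightarrow{\eta_{a,H'(a,c)}}H(a,T(a,H'(a,c)))\xrightarrow{H(a,\theta_{a,H'(a,c)})}H(a,T'(a,H'(a,c)))\xrightarrow{H(a,\epsilon'_{a,c})}H(a,c).$$ For a natural transformation $T'\Rightarrow T$, $j_{\mathrm{l}}$ is defined by the same formula with the roles of the two adjunctions exchanged, giving a natural transformation $H\Rightarrow H'$. *)

theory Defs
  imports Main "HOL-Library.FuncSet"
begin

record ('o, 'm) cat =
  Obj :: "'o set"
  Arr :: "'m set"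
  Dom :: "'m \<Rightarrow> 'o"
  Cod :: "'m \<Rightarrow> 'o"
  Id :: "'o \<Rightarrow> 'm"
  Comp :: "'m \<Rightarrow> 'm \<Rightarrow> 'm"  (infixr "\<cdot>\<index>" 70)

definition Hom :: "('o, 'm) cat \<Rightarrow> 'o \<Rightarrow> 'o \<Rightarrow> 'm set" where
  "Hom C x y = {f \<in> Arr C. Dom C f = x \<and> Cod C f = y}"

text \<open>The fields of the record are total functions; nothing is assumed about \<open>Dom\<close>, \<open>Cod\<close>, \<open>Id\<close>
  outside \<open>Arr\<close> and \<open>Obj\<close>, nor about \<open>Comp\<close> on non-composable pairs.\<close>

locale category =
  fixes C :: "('o, 'm) cat" (structure)
  assumes Dom_Obj: "f \<in> Arr C \<Longrightarrow> Dom C f \<in> Obj C"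
    and Cod_Obj: "f \<in> Arr C \<Longrightarrow> Cod C f \<in> Obj C"
    and Id_Hom: "x \<in> Obj C \<Longrightarrow> Id C x \<in> Hom C x x"
    and Comp_Hom: "\<lbrakk>f \<in> Hom C x y; g \<in> Hom C y z\<rbrakk> \<Longrightarrow> g \<cdot> f \<in> Hom C x z"
    and Id_left: "f \<in> Hom C x y \<Longrightarrow> Id C y \<cdot> f = f"
    and Id_right: "f \<in> Hom C x y \<Longrightarrow> f \<cdot> Id C x = f"
    and Comp_assoc: "\<lbrakk>f \<in> Hom C w x; g \<in> Hom C x y; h \<in> Hom C y z\<rbrakk> \<Longrightarrow> (h \<cdot> g) \<cdot> f = h \<cdot> (g \<cdot> f)"

definition op_cat :: "('o, 'm) cat \<Rightarrow> ('o, 'm) cat" where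
  "op_cat C = \<lparr>Obj = Obj C, Arr = Arr C, Dom = Cod C, Cod = Dom C, Id = Id C,
     Comp = (\<lambda>g f. Comp C f g)\<rparr>"

definition prod_cat :: "('o1, 'm1) cat \<Rightarrow> ('o2, 'm2) cat \<Rightarrow> ('o1 \<times> 'o2, 'm1 \<times> 'm2) cat"
    (infixr "\<times>\<^sub>C" 75) where
  "A \<times>\<^sub>C B = \<lparr>Obj = Obj A \<times> Obj B, Arr = Arr A \<times> Arr B,
     Dom = (\<lambda>(f, g). (Dom A f, Dom B g)), Cod = (\<lambda>(f, g). (Cod A f, Cod B g)),
     Id = (\<lambda>(x, y). (Id A x, Id B y)),
     Comp = (\<lambda>(f', g') (f, g). (Comp A f' f, Comp B g' g))\<rparr>"

lemma Hom_op_cat: "Hom (op_cat C) x y = Hom C y x"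
  by (auto simp: Hom_def op_cat_def)

lemma Hom_prod_cat: "Hom (A \<times>\<^sub>C B) x y = Hom A (fst x) (fst y) \<times> Hom B (snd x) (snd y)"
  by (auto simp: Hom_def prod_cat_def)

lemma category_op_cat:
  assumes "category C" shows "category (op_cat C)"
proof -
  interpret category C by fact
  show ?thesis
  proof (unfold_locales, unfold Hom_op_cat)
  qed (use Dom_Obj Cod_Obj in \<open>auto simp: op_cat_def intro: Id_Hom Comp_Hom Id_left Id_right Comp_assoc[symmetric]\<close>)
qed

lemma category_prod_cat:
  assumes "category A" "category B" shows "category (A \<times>\<^sub>C B)"
proof -
  interpret A: category A by fact
  interpret B: category B by fact
  show ?thesis
  proof (unfold_locales, unfold Hom_prod_cat)
  qed (use A.Dom_Obj A.Cod_Obj B.Dom_Obj B.Cod_Obj in \<open>auto simp: prod_cat_def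
      intro: A.Id_Hom A.Comp_Hom A.Id_left A.Id_right A.Comp_assoc
        B.Id_Hom B.Comp_Hom B.Id_left B.Id_right B.Comp_assoc\<close>)
qed

record ('o1, 'm1, 'o2, 'm2) fctr =
  OMap :: "'o1 \<Rightarrow> 'o2"
  AMap :: "'m1 \<Rightarrow> 'm2"

locale is_functor = A: category A + B: category B
  for A :: "('o1, 'm1) cat" and B :: "('o2, 'm2) cat" +
  fixes F :: "('o1, 'm1, 'o2, 'm2) fctr"
  assumes OMap_Obj: "x \<in> Obj A \<Longrightarrow> OMap F x \<in> Obj B"
    and AMap_Hom: "f \<in> Hom A x y \<Longrightarrow> AMap F f \<in> Hom B (OMap F x) (OMap F y)"
    and AMap_Id: "x \<in> Obj A \<Longrightarrow> AMap F (Id A x) = Id B (OMap F x)"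
    and AMap_Comp: "\<lbrakk>f \<in> Hom A x y; g \<in> Hom A y z\<rbrakk>
      \<Longrightarrow> AMap F (g \<cdot>\<^bsub>A\<^esub> f) = AMap F g \<cdot>\<^bsub>B\<^esub> AMap F f"

text \<open>The family of components is required to be \<open>undefined\<close> off the objects, so that HOL equality
  of families is equality of natural transformations.\<close>

locale nat_trans = F: is_functor A B F + G: is_functor A B G
  for A :: "('o1, 'm1) cat" and B :: "('o2, 'm2) cat"
    and F G :: "('o1, 'm1, 'o2, 'm2) fctr" +
  fixes \<tau> :: "'o1 \<Rightarrow> 'm2"
  assumes extensional: "\<tau> \<in> extensional (Obj A)"
    and component: "x \<in> Obj A \<Longrightarrow> \<tau> x \<in> Hom B (OMap F x) (OMap G x)"
    and natural: "f \<in> Hom A x y \<Longrightarrow> \<tau> y \<cdot>\<^bsub>B\<^esub> AMap F f = AMap G f \<cdot>\<^bsub>B\<^esub> \<tau> x"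

definition id_nt :: "('o1, 'm1) cat \<Rightarrow> ('o2, 'm2) cat \<Rightarrow> ('o1, 'm1, 'o2, 'm2) fctr \<Rightarrow> 'o1 \<Rightarrow> 'm2" where
  "id_nt A B F = (\<lambda>x\<in>Obj A. Id B (OMap F x))"

definition comp_nt :: "('o1, 'm1) cat \<Rightarrow> ('o2, 'm2) cat \<Rightarrow> ('o1 \<Rightarrow> 'm2) \<Rightarrow> ('o1 \<Rightarrow> 'm2) \<Rightarrow> 'o1 \<Rightarrow> 'm2" where
  "comp_nt A B \<sigma> \<tau> = (\<lambda>x\<in>Obj A. \<sigma> x \<cdot>\<^bsub>B\<^esub> \<tau> x)"

definition inverse_nt :: "('o1, 'm1) cat \<Rightarrow> ('o2, 'm2) cat \<Rightarrow> ('o1, 'm1, 'o2, 'm2) fctr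
    \<Rightarrow> ('o1, 'm1, 'o2, 'm2) fctr \<Rightarrow> ('o1 \<Rightarrow> 'm2) \<Rightarrow> ('o1 \<Rightarrow> 'm2) \<Rightarrow> bool" where
  "inverse_nt A B F G \<tau> \<sigma> \<longleftrightarrow> nat_trans A B F G \<tau> \<and> nat_trans A B G F \<sigma>
     \<and> comp_nt A B \<sigma> \<tau> = id_nt A B F \<and> comp_nt A B \<tau> \<sigma> = id_nt A B G"

text \<open>Below, an object in an argument place of a bifunctor applied to arrows stands for its
  identity arrow. An arrow \<open>f : a \<rightarrow> a'\<close> of \<open>A\<close> is an arrow \<open>a' \<rightarrow> a\<close> of \<open>op_cat A\<close>, so that
  \<open>H(f, c) : H(a', c) \<rightarrow> H(a, c)\<close>.\<close>

locale left_adjunction2 = T: is_functor "A \<times>\<^sub>C B" C T + H: is_functor "op_cat A \<times>\<^sub>C C" B H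
    + A: category A + B: category B + C: category C
  for A :: "('oa, 'ma) cat" and B :: "('ob, 'mb) cat" and C :: "('oc, 'mc) cat"
    and T :: "('oa \<times> 'ob, 'ma \<times> 'mb, 'oc, 'mc) fctr"
    and H :: "('oa \<times> 'oc, 'ma \<times> 'mc, 'ob, 'mb) fctr" +
  fixes \<epsilon> :: "'oa \<Rightarrow> 'oc \<Rightarrow> 'mc" and \<eta> :: "'oa \<Rightarrow> 'ob \<Rightarrow> 'mb"
  assumes counit_Hom: "\<lbrakk>a \<in> Obj A; c \<in> Obj C\<rbrakk> \<Longrightarrow> \<epsilon> a c \<in> Hom C (OMap T (a, OMap H (a, c))) c"
    and unit_Hom: "\<lbrakk>a \<in> Obj A; b \<in> Obj B\<rbrakk> \<Longrightarrow> \<eta> a b \<in> Hom B b (OMap H (a, OMap T (a, b)))"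
    and counit_natural: "\<lbrakk>a \<in> Obj A; g \<in> Hom C c c'\<rbrakk>
      \<Longrightarrow> \<epsilon> a c' \<cdot>\<^bsub>C\<^esub> AMap T (Id A a, AMap H (Id A a, g)) = g \<cdot>\<^bsub>C\<^esub> \<epsilon> a c"
    and unit_natural: "\<lbrakk>a \<in> Obj A; h \<in> Hom B b b'\<rbrakk>
      \<Longrightarrow> AMap H (Id A a, AMap T (Id A a, h)) \<cdot>\<^bsub>B\<^esub> \<eta> a b = \<eta> a b' \<cdot>\<^bsub>B\<^esub> h"
    and counit_extranatural: "\<lbrakk>f \<in> Hom A a a'; c \<in> Obj C\<rbrakk>
      \<Longrightarrow> \<epsilon> a c \<cdot>\<^bsub>C\<^esub> AMap T (Id A a, AMap H (f, Id C c))
        = \<epsilon> a' c \<cdot>\<^bsub>C\<^esub> AMap T (f, Id B (OMap H (a', c)))"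
    and unit_extranatural: "\<lbrakk>f \<in> Hom A a a'; b \<in> Obj B\<rbrakk>
      \<Longrightarrow> AMap H (f, Id C (OMap T (a', b))) \<cdot>\<^bsub>B\<^esub> \<eta> a' b
        = AMap H (Id A a, AMap T (f, Id B b)) \<cdot>\<^bsub>B\<^esub> \<eta> a b"
    and triangle_H: "\<lbrakk>a \<in> Obj A; c \<in> Obj C\<rbrakk>
      \<Longrightarrow> AMap H (Id A a, \<epsilon> a c) \<cdot>\<^bsub>B\<^esub> \<eta> a (OMap H (a, c)) = Id B (OMap H (a, c))"
    and triangle_T: "\<lbrakk>a \<in> Obj A; b \<in> Obj B\<rbrakk>
      \<Longrightarrow> \<epsilon> a (OMap T (a, b)) \<cdot>\<^bsub>C\<^esub> AMap T (Id A a, \<eta> a b) = Id C (OMap T (a, b))"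

text \<open>For \<open>T \<stileturn> H\<close> with unit \<open>\<eta>\<close>, \<open>T' \<stileturn> H'\<close> with counit \<open>\<epsilon>'\<close>, and \<open>\<theta> : T \<Rightarrow> T'\<close>, this is the
  conjugate \<open>H' \<Rightarrow> H\<close>. The functors \<open>T\<close>, \<open>T'\<close> themselves do not occur in the formula.\<close>

definition conj_l :: "('oa, 'ma) cat \<Rightarrow> ('ob, 'mb) cat \<Rightarrow> ('oc, 'mc) cat
    \<Rightarrow> ('oa \<times> 'oc, 'ma \<times> 'mc, 'ob, 'mb) fctr \<Rightarrow> ('oa \<Rightarrow> 'ob \<Rightarrow> 'mb)
    \<Rightarrow> ('oa \<times> 'oc, 'ma \<times> 'mc, 'ob, 'mb) fctr \<Rightarrow> ('oa \<Rightarrow> 'oc \<Rightarrow> 'mc)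
    \<Rightarrow> ('oa \<times> 'ob \<Rightarrow> 'mc) \<Rightarrow> ('oa \<times> 'oc \<Rightarrow> 'mb)" where
  "conj_l A B C H \<eta> H' \<epsilon>' \<theta> = (\<lambda>(a, c) \<in> Obj (op_cat A \<times>\<^sub>C C).
     AMap H (Id A a, \<epsilon>' a c) \<cdot>\<^bsub>B\<^esub> AMap H (Id A a, \<theta> (a, OMap H' (a, c))) \<cdot>\<^bsub>B\<^esub> \<eta> a (OMap H' (a, c)))"

end

theory Submission
  imports Defs
begin

text \<open>
  For a fixed object \<open>a\<close> of \<open>A\<close>, a left-sided adjunction of two variables is an ordinary adjunction
  \<open>T(a, -) \<stileturn> H(a, -)\<close>. An arrow \<open>h : b \<rightarrow> H(a, c)\<close> is therefore determined by its transpose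
  \<open>\<epsilon> \<circ> T(a, h) : T(a, b) \<rightarrow> c\<close>, and the conjugate \<open>\<sigma>\<close> of \<open>\<theta>\<close> is the unique family satisfying
  \<open>\<epsilon> \<circ> T(a, \<sigma>) = \<epsilon>' \<circ> \<theta>\<close>. This single equation replaces the formula for \<open>\<sigma>\<close>: it gives naturality of
  \<open>\<sigma>\<close> (\<open>conjugate_natural\<close>) and shows that conjugation preserves identities and reverses composition
  (\<open>conjugate_id\<close>, \<open>conjugate_comp\<close>). Hence conjugation sends inverse pairs to inverse pairs.

  For the converse, passing to opposite categories exchanges the roles of \<open>T\<close> and \<open>H\<close> and of unit and
  counit: \<open>H\<close> and \<open>T\<close>, read as functors \<open>A \<times> C\<^sup>o\<^sup>p \<rightarrow> B\<^sup>o\<^sup>p\<close> and \<open>A\<^sup>o\<^sup>p \<times> B\<^sup>o\<^sup>p \<rightarrow> C\<^sup>o\<^sup>p\<close>, form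
  a left-sided adjunction again (\<open>left_adjunction2_dual\<close>). Conjugation for the dual adjunctions takes
  transformations \<open>H' \<Rightarrow> H\<close> back to transformations \<open>T \<Rightarrow> T'\<close>, it sends inverse pairs to inverse
  pairs by what was already proved, and it takes the conjugate of \<open>\<theta>\<close> back to \<open>\<theta>\<close>
  (\<open>dual_conjugate_conjugate\<close>). So an inverse of the conjugate yields an inverse of \<open>\<theta>\<close>.
\<close>

section \<open>Opposite categories and duality\<close>

lemma op_cat_simps [simp]:
  "Obj (op_cat C) = Obj C" "Arr (op_cat C) = Arr C" "Id (op_cat C) = Id C"
  "Comp (op_cat C) g f = Comp C f g"
  by (simp_all add: op_cat_def)

lemma prod_cat_simps [simp]:
  "Obj (A \<times>\<^sub>C B) = Obj A \<times> Obj B"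
  "Id (A \<times>\<^sub>C B) (x, y) = (Id A x, Id B y)"
  "Comp (A \<times>\<^sub>C B) (f', g') (f, g) = (Comp A f' f, Comp B g' g)"
  by (simp_all add: prod_cat_def)

lemma op_cat_op_cat [simp]:
  fixes C :: "('o, 'm) cat"
  shows "op_cat (op_cat C) = C"
  by (simp add: op_cat_def)

lemma op_cat_prod_cat: "op_cat (A \<times>\<^sub>C B) = op_cat A \<times>\<^sub>C op_cat B"
  by (auto simp: op_cat_def prod_cat_def fun_eq_iff)

lemma is_functor_op:
  assumes "is_functor A B F"
  shows "is_functor (op_cat A) (op_cat B) F"
proof -
  interpret F: is_functor A B F by fact
  show ?thesis
    by (intro is_functor.intro is_functor_axioms.intro category_op_cat F.A.category_axioms
        F.B.category_axioms) (auto simp: Hom_op_cat F.OMap_Obj F.AMap_Hom F.AMap_Id F.AMap_Comp)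
qed

lemma nat_trans_op:
  assumes "nat_trans A B F G \<tau>"
  shows "nat_trans (op_cat A) (op_cat B) G F \<tau>"
proof -
  interpret nat_trans A B F G \<tau> by fact
  show ?thesis
    by (intro nat_trans.intro nat_trans_axioms.intro is_functor_op F.is_functor_axioms
        G.is_functor_axioms) (auto simp: Hom_op_cat extensional component natural)
qed

lemma inverse_nt_op:
  assumes "inverse_nt A B F G \<tau> \<sigma>"
  shows "inverse_nt (op_cat A) (op_cat B) G F \<tau> \<sigma>"
  using assms by (auto simp: inverse_nt_def nat_trans_op comp_nt_def id_nt_def)

text \<open>Reversing arrows in \<open>B\<close> and \<open>C\<close> turns \<open>\<epsilon>\<close> into a unit and \<open>\<eta>\<close> into a counit. The variance of
  both functors in \<open>A\<close> is reversed too, and that is exactly what their exchange requires.\<close>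

lemma left_adjunction2_dual:
  assumes "left_adjunction2 A B C T H \<epsilon> \<eta>"
  shows "left_adjunction2 A (op_cat C) (op_cat B) H T \<eta> \<epsilon>"
proof -
  interpret left_adjunction2 A B C T H \<epsilon> \<eta> by fact
  have "is_functor (A \<times>\<^sub>C op_cat C) (op_cat B) H"
    using is_functor_op[OF H.is_functor_axioms] by (simp add: op_cat_prod_cat)
  moreover have "is_functor (op_cat A \<times>\<^sub>C op_cat B) (op_cat C) T"
    using is_functor_op[OF T.is_functor_axioms] by (simp add: op_cat_prod_cat)
  ultimately show ?thesis
    by (intro left_adjunction2.intro left_adjunction2_axioms.intro category_op_cat
        A.category_axioms H.B.category_axioms T.B.category_axioms)
      (auto simp: Hom_op_cat triangle_H triangle_T intro: counit_Hom unit_Hom counit_natural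
        unit_natural counit_extranatural[symmetric] unit_extranatural[symmetric])
qed

section \<open>Uniqueness of inverses\<close>

lemma nat_trans_eqI:
  assumes "nat_trans A B F G \<sigma>" "nat_trans A B F G \<tau>" "\<And>x. x \<in> Obj A \<Longrightarrow> \<sigma> x = \<tau> x"
  shows "\<sigma> = \<tau>"
  using assms by (auto intro: extensionalityI dest: nat_trans.extensional)

lemma nat_trans_comp:
  assumes "nat_trans A B F G \<tau>" and "nat_trans A B G K \<sigma>"
  shows "nat_trans A B F K (comp_nt A B \<sigma> \<tau>)"
proof -
  interpret \<tau>: nat_trans A B F G \<tau> by fact
  interpret \<sigma>: nat_trans A B G K \<sigma> by fact
  note B = \<tau>.F.B.Comp_assoc \<tau>.F.B.Comp_Hom
  have "comp_nt A B \<sigma> \<tau> y \<cdot>\<^bsub>B\<^esub> AMap F f = AMap K f \<cdot>\<^bsub>B\<^esub> comp_nt A B \<sigma> \<tau> x"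
    if f: "f \<in> Hom A x y" for f x y
  proof -
    have xy: "x \<in> Obj A" "y \<in> Obj A"
      using f \<tau>.F.A.Dom_Obj \<tau>.F.A.Cod_Obj by (auto simp: Hom_def)
    note h = \<tau>.component[OF xy(1)] \<tau>.component[OF xy(2)] \<sigma>.component[OF xy(1)]
      \<sigma>.component[OF xy(2)] \<tau>.F.AMap_Hom[OF f] \<tau>.G.AMap_Hom[OF f] \<sigma>.G.AMap_Hom[OF f]
    have "(\<sigma> y \<cdot>\<^bsub>B\<^esub> \<tau> y) \<cdot>\<^bsub>B\<^esub> AMap F f = \<sigma> y \<cdot>\<^bsub>B\<^esub> AMap G f \<cdot>\<^bsub>B\<^esub> \<tau> x"
      by (simp add: B(1)[OF h(5) h(2) h(4)] \<tau>.natural[OF f])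
    also have "\<dots> = AMap K f \<cdot>\<^bsub>B\<^esub> \<sigma> x \<cdot>\<^bsub>B\<^esub> \<tau> x"
      by (simp add: B(1)[OF h(1) h(6) h(4), symmetric] \<sigma>.natural[OF f] B(1)[OF h(1) h(3) h(7)])
    finally show ?thesis using xy by (simp add: comp_nt_def)
  qed
  then show ?thesis
    by (intro nat_trans.intro nat_trans_axioms.intro \<tau>.F.is_functor_axioms \<sigma>.G.is_functor_axioms)
      (auto simp: comp_nt_def intro: B(2) \<tau>.component \<sigma>.component)
qed

lemma inverse_nt_unique:
  assumes "inverse_nt A B F G \<tau> \<sigma>" and "inverse_nt A B F G \<tau> \<sigma>'"
  shows "\<sigma> = \<sigma>'"
proof -
  have n: "nat_trans A B F G \<tau>" "nat_trans A B G F \<sigma>" "nat_trans A B G F \<sigma>'"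
    using assms by (auto simp: inverse_nt_def)
  interpret \<tau>: nat_trans A B F G \<tau> by fact
  interpret \<sigma>: nat_trans A B G F \<sigma> by fact
  interpret \<sigma>': nat_trans A B G F \<sigma>' by fact
  show ?thesis
  proof (rule nat_trans_eqI[OF n(2,3)])
    fix x assume x: "x \<in> Obj A"
    note h = \<tau>.component[OF x] \<sigma>.component[OF x] \<sigma>'.component[OF x]
    have "\<sigma> x \<cdot>\<^bsub>B\<^esub> \<tau> x = Id B (OMap F x)"
      using assms(1) x by (auto simp: inverse_nt_def comp_nt_def id_nt_def dest!: fun_cong[where x = x])
    moreover have "\<tau> x \<cdot>\<^bsub>B\<^esub> \<sigma>' x = Id B (OMap G x)"
      using assms(2) x by (auto simp: inverse_nt_def comp_nt_def id_nt_def dest!: fun_cong[where x = x])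
    ultimately show "\<sigma> x = \<sigma>' x"
      using \<tau>.F.B.Comp_assoc[OF h(3) h(1) h(2)] \<tau>.F.B.Id_left[OF h(3)] \<tau>.F.B.Id_right[OF h(2)]
      by simp
  qed
qed

section \<open>Transposes\<close>

context left_adjunction2
begin

(* The qualifiers T.B and H.B refer to the codomain categories of T and H, which are C and B. *)

lemma T_Hom:
  "\<lbrakk>f \<in> Hom A a a'; h \<in> Hom B b b'\<rbrakk> \<Longrightarrow> AMap T (f, h) \<in> Hom C (OMap T (a, b)) (OMap T (a', b'))"
  by (rule T.AMap_Hom) (simp add: Hom_prod_cat)

lemma H_Hom:
  "\<lbrakk>f \<in> Hom A a a'; g \<in> Hom C c c'\<rbrakk> \<Longrightarrow> AMap H (f, g) \<in> Hom B (OMap H (a', c)) (OMap H (a, c'))"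
  by (rule H.AMap_Hom) (simp add: Hom_prod_cat Hom_op_cat)

lemma T_Obj: "\<lbrakk>a \<in> Obj A; b \<in> Obj B\<rbrakk> \<Longrightarrow> OMap T (a, b) \<in> Obj C"
  by (rule T.OMap_Obj) simp

lemma H_Obj: "\<lbrakk>a \<in> Obj A; c \<in> Obj C\<rbrakk> \<Longrightarrow> OMap H (a, c) \<in> Obj B"
  by (rule H.OMap_Obj) simp

lemma T_Comp:
  "\<lbrakk>f \<in> Hom A a a'; f' \<in> Hom A a' a''; h \<in> Hom B b b'; h' \<in> Hom B b' b''\<rbrakk>
    \<Longrightarrow> AMap T (f', h') \<cdot>\<^bsub>C\<^esub> AMap T (f, h) = AMap T (f' \<cdot>\<^bsub>A\<^esub> f, h' \<cdot>\<^bsub>B\<^esub> h)"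
  using T.AMap_Comp[of "(f, h)" "(a, b)" "(a', b')" "(f', h')" "(a'', b'')"]
  by (simp add: Hom_prod_cat)

lemma H_Comp:
  "\<lbrakk>f \<in> Hom A a a'; f' \<in> Hom A a' a''; g \<in> Hom C c c'; g' \<in> Hom C c' c''\<rbrakk>
    \<Longrightarrow> AMap H (f, g') \<cdot>\<^bsub>B\<^esub> AMap H (f', g) = AMap H (f' \<cdot>\<^bsub>A\<^esub> f, g' \<cdot>\<^bsub>C\<^esub> g)"
  using H.AMap_Comp[of "(f', g)" "(a'', c)" "(a', c')" "(f, g')" "(a, c'')"]
  by (simp add: Hom_prod_cat Hom_op_cat)

lemma T_Comp_Id:
  assumes "a \<in> Obj A" "h \<in> Hom B b b'" "h' \<in> Hom B b' b''"
  shows "AMap T (Id A a, h') \<cdot>\<^bsub>C\<^esub> AMap T (Id A a, h) = AMap T (Id A a, h' \<cdot>\<^bsub>B\<^esub> h)"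
  using T_Comp[OF A.Id_Hom A.Id_Hom assms(2,3)] assms(1) A.Id_left[OF A.Id_Hom] by simp

lemma H_Comp_Id:
  assumes "a \<in> Obj A" "g \<in> Hom C c c'" "g' \<in> Hom C c' c''"
  shows "AMap H (Id A a, g') \<cdot>\<^bsub>B\<^esub> AMap H (Id A a, g) = AMap H (Id A a, g' \<cdot>\<^bsub>C\<^esub> g)"
  using H_Comp[OF A.Id_Hom A.Id_Hom assms(2,3)] assms(1) A.Id_left[OF A.Id_Hom] by simp

text \<open>The transpose of \<open>h : b \<rightarrow> H(a, c)\<close> under the adjunction \<open>T(a, -) \<stileturn> H(a, -)\<close>.\<close>

definition transpose :: "'oa \<Rightarrow> 'oc \<Rightarrow> 'mb \<Rightarrow> 'mc" where
  "transpose a c h = \<epsilon> a c \<cdot>\<^bsub>C\<^esub> AMap T (Id A a, h)"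

lemma transpose_Comp:
  assumes "a \<in> Obj A" "c \<in> Obj C" "k \<in> Hom B b b'" "h \<in> Hom B b' (OMap H (a, c))"
  shows "transpose a c (h \<cdot>\<^bsub>B\<^esub> k) = transpose a c h \<cdot>\<^bsub>C\<^esub> AMap T (Id A a, k)"
  unfolding transpose_def T_Comp_Id[OF assms(1,3,4), symmetric]
  by (rule T.B.Comp_assoc[symmetric, OF T_Hom[OF A.Id_Hom[OF assms(1)] assms(3)]
        T_Hom[OF A.Id_Hom[OF assms(1)] assms(4)] counit_Hom[OF assms(1,2)]])

text \<open>Naturality of the counit in \<open>c\<close> and its extranaturality in \<open>a\<close>, in one equation.\<close>

lemma transpose_AMap:
  assumes f: "f \<in> Hom A a a'" and g: "g \<in> Hom C c c'"
  shows "transpose a c' (AMap H (f, g)) = g \<cdot>\<^bsub>C\<^esub> \<epsilon> a' c \<cdot>\<^bsub>C\<^esub> AMap T (f, Id B (OMap H (a', c)))"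
proof -
  have o: "a \<in> Obj A" "a' \<in> Obj A" "c \<in> Obj C" "c' \<in> Obj C"
    using f g A.Dom_Obj A.Cod_Obj T.B.Dom_Obj T.B.Cod_Obj by (auto simp: Hom_def)
  note ia = A.Id_Hom[OF o(1)] and ic = T.B.Id_Hom[OF o(3)]
  have "AMap H (f, g) = AMap H (Id A a, g) \<cdot>\<^bsub>B\<^esub> AMap H (f, Id C c)"
    by (simp add: H_Comp[OF ia f ic g] A.Id_right[OF f] T.B.Id_right[OF g])
  then have "transpose a c' (AMap H (f, g))
      = (\<epsilon> a c' \<cdot>\<^bsub>C\<^esub> AMap T (Id A a, AMap H (Id A a, g))) \<cdot>\<^bsub>C\<^esub> AMap T (Id A a, AMap H (f, Id C c))"
    using transpose_Comp[OF o(1,4) H_Hom[OF f ic] H_Hom[OF ia g]] by (simp add: transpose_def)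
  also have "\<dots> = g \<cdot>\<^bsub>C\<^esub> \<epsilon> a c \<cdot>\<^bsub>C\<^esub> AMap T (Id A a, AMap H (f, Id C c))"
    using T.B.Comp_assoc[OF T_Hom[OF ia H_Hom[OF f ic]] counit_Hom[OF o(1,3)] g]
    by (simp add: counit_natural[OF o(1) g])
  finally show ?thesis by (simp add: counit_extranatural[OF f o(3)])
qed

text \<open>Each of the two triangle identities makes transposition invertible on one side; the inverse
  sends \<open>g : T(a, b) \<rightarrow> c\<close> to \<open>H(a, g) \<circ> \<eta>\<close>.\<close>

lemma transpose_unit:
  assumes a: "a \<in> Obj A" and b: "b \<in> Obj B" and g: "g \<in> Hom C (OMap T (a, b)) c"
  shows "transpose a c (AMap H (Id A a, g) \<cdot>\<^bsub>B\<^esub> \<eta> a b) = g"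
proof -
  have c: "c \<in> Obj C" using g T.B.Cod_Obj by (auto simp: Hom_def)
  note ia = A.Id_Hom[OF a] and t = T_Obj[OF a b] and e = unit_Hom[OF a b]
  have "transpose a c (AMap H (Id A a, g) \<cdot>\<^bsub>B\<^esub> \<eta> a b)
      = (g \<cdot>\<^bsub>C\<^esub> \<epsilon> a (OMap T (a, b))) \<cdot>\<^bsub>C\<^esub> AMap T (Id A a, \<eta> a b)"
    by (simp add: transpose_Comp[OF a c e H_Hom[OF ia g]]) (simp add: transpose_def counit_natural[OF a g])
  also have "\<dots> = g"
    by (simp add: T.B.Comp_assoc[OF T_Hom[OF ia e] counit_Hom[OF a t] g] triangle_T[OF a b] T.B.Id_right[OF g])
  finally show ?thesis .
qed

lemma unit_transpose:
  assumes a: "a \<in> Obj A" and c: "c \<in> Obj C" and h: "h \<in> Hom B b (OMap H (a, c))"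
  shows "AMap H (Id A a, transpose a c h) \<cdot>\<^bsub>B\<^esub> \<eta> a b = h"
proof -
  have b: "b \<in> Obj B" using h H.B.Dom_Obj by (auto simp: Hom_def)
  note ia = A.Id_Hom[OF a] and th = T_Hom[OF A.Id_Hom[OF a] h] and e = counit_Hom[OF a c]
  have "AMap H (Id A a, transpose a c h) \<cdot>\<^bsub>B\<^esub> \<eta> a b
      = AMap H (Id A a, \<epsilon> a c) \<cdot>\<^bsub>B\<^esub> \<eta> a (OMap H (a, c)) \<cdot>\<^bsub>B\<^esub> h"
    by (simp add: transpose_def H_Comp_Id[OF a th e, symmetric] unit_natural[OF a h]
        H.B.Comp_assoc[OF unit_Hom[OF a b] H_Hom[OF ia th] H_Hom[OF ia e]])
  also have "\<dots> = h"
    by (simp add: H.B.Comp_assoc[OF h unit_Hom[OF a H_Obj[OF a c]] H_Hom[OF ia e], symmetric]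
        triangle_H[OF a c] H.B.Id_left[OF h])
  finally show ?thesis .
qed

lemma transpose_inject:
  assumes "a \<in> Obj A" "c \<in> Obj C" "h \<in> Hom B b (OMap H (a, c))" "h' \<in> Hom B b (OMap H (a, c))"
    and "transpose a c h = transpose a c h'"
  shows "h = h'"
  using unit_transpose[OF assms(1-3)] unit_transpose[OF assms(1,2,4)] unfolding assms(5)
  by (rule trans[OF sym])

end

section \<open>Conjugation\<close>

locale conjugation =
  L: left_adjunction2 A B C T H \<epsilon> \<eta> + L': left_adjunction2 A B C T' H' \<epsilon>' \<eta>'
  + \<theta>: nat_trans "A \<times>\<^sub>C B" C T T' \<theta>
  for A :: "('oa, 'ma) cat" and B :: "('ob, 'mb) cat" and C :: "('oc, 'mc) cat"
    and T H \<epsilon> \<eta> T' H' \<epsilon>' \<eta>' \<theta>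
begin

abbreviation conjugate :: "'oa \<times> 'oc \<Rightarrow> 'mb" where
  "conjugate \<equiv> conj_l A B C H \<eta> H' \<epsilon>' \<theta>"

lemma \<theta>_Hom: "\<lbrakk>a \<in> Obj A; b \<in> Obj B\<rbrakk> \<Longrightarrow> \<theta> (a, b) \<in> Hom C (OMap T (a, b)) (OMap T' (a, b))"
  by (rule \<theta>.component) simp

lemma \<theta>_natural:
  "\<lbrakk>f \<in> Hom A a a'; h \<in> Hom B b b'\<rbrakk>
    \<Longrightarrow> \<theta> (a', b') \<cdot>\<^bsub>C\<^esub> AMap T (f, h) = AMap T' (f, h) \<cdot>\<^bsub>C\<^esub> \<theta> (a, b)"
  by (rule \<theta>.natural) (simp add: Hom_prod_cat)

lemma conjugate_eq:
  assumes a: "a \<in> Obj A" and c: "c \<in> Obj C"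
  shows "conjugate (a, c)
    = AMap H (Id A a, \<epsilon>' a c \<cdot>\<^bsub>C\<^esub> \<theta> (a, OMap H' (a, c))) \<cdot>\<^bsub>B\<^esub> \<eta> a (OMap H' (a, c))"
proof -
  note b = L'.H_Obj[OF a c] and ia = L.A.Id_Hom[OF a] and e = L'.counit_Hom[OF a c]
  note t = \<theta>_Hom[OF a b]
  show ?thesis
    unfolding L.H_Comp_Id[OF a t e, symmetric]
      L.H.B.Comp_assoc[OF L.unit_Hom[OF a b] L.H_Hom[OF ia t] L.H_Hom[OF ia e]]
    using a c by (simp add: conj_l_def)
qed

lemma conjugate_Hom:
  assumes a: "a \<in> Obj A" and c: "c \<in> Obj C"
  shows "conjugate (a, c) \<in> Hom B (OMap H' (a, c)) (OMap H (a, c))"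
  unfolding conjugate_eq[OF a c] using L'.H_Obj[OF a c] a c
  by (intro L.H.B.Comp_Hom[OF L.unit_Hom L.H_Hom] L.A.Id_Hom
      L.T.B.Comp_Hom[OF \<theta>_Hom L'.counit_Hom])

text \<open>The equation that characterises the conjugate. It holds because the defining formula is the
  inverse of transposition applied to \<open>\<epsilon>' \<circ> \<theta>\<close>.\<close>

lemma transpose_conjugate:
  assumes a: "a \<in> Obj A" and c: "c \<in> Obj C"
  shows "L.transpose a c (conjugate (a, c)) = \<epsilon>' a c \<cdot>\<^bsub>C\<^esub> \<theta> (a, OMap H' (a, c))"
  unfolding conjugate_eq[OF a c] using a c
  by (intro L.transpose_unit L'.H_Obj L.T.B.Comp_Hom[OF \<theta>_Hom] L'.counit_Hom)

text \<open>The characterising equation extended along an arrow \<open>h\<close> by naturality of \<open>\<theta>\<close>. It moves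
  computations from the first adjunction to the second.\<close>

lemma transpose_conjugate_Comp:
  assumes a: "a \<in> Obj A" and c: "c \<in> Obj C" and h: "h \<in> Hom B b (OMap H' (a, c))"
  shows "L.transpose a c (conjugate (a, c) \<cdot>\<^bsub>B\<^esub> h) = L'.transpose a c h \<cdot>\<^bsub>C\<^esub> \<theta> (a, b)"
proof -
  have b: "b \<in> Obj B" using h L.H.B.Dom_Obj by (auto simp: Hom_def)
  note ia = L.A.Id_Hom[OF a] and e = L'.counit_Hom[OF a c]
  have "L.transpose a c (conjugate (a, c) \<cdot>\<^bsub>B\<^esub> h)
      = (\<epsilon>' a c \<cdot>\<^bsub>C\<^esub> \<theta> (a, OMap H' (a, c))) \<cdot>\<^bsub>C\<^esub> AMap T (Id A a, h)"
    by (simp add: L.transpose_Comp[OF a c h conjugate_Hom[OF a c]] transpose_conjugate[OF a c])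
  also have "\<dots> = \<epsilon>' a c \<cdot>\<^bsub>C\<^esub> AMap T' (Id A a, h) \<cdot>\<^bsub>C\<^esub> \<theta> (a, b)"
    by (simp add: L.T.B.Comp_assoc[OF L.T_Hom[OF ia h] \<theta>_Hom[OF a L'.H_Obj[OF a c]] e] \<theta>_natural[OF ia h])
  also have "\<dots> = L'.transpose a c h \<cdot>\<^bsub>C\<^esub> \<theta> (a, b)"
    by (simp add: L'.transpose_def L.T.B.Comp_assoc[OF \<theta>_Hom[OF a b] L'.T_Hom[OF ia h] e])
  finally show ?thesis .
qed

text \<open>Both sides of the naturality square are arrows into \<open>H(a, c')\<close>. Their transposes agree: both
  equal \<open>g \<circ> \<epsilon>' \<circ> T'(f, H'(a', c)) \<circ> \<theta>\<close>.\<close>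

lemma conjugate_natural:
  assumes f: "f \<in> Hom A a a'" and g: "g \<in> Hom C c c'"
  shows "conjugate (a, c') \<cdot>\<^bsub>B\<^esub> AMap H' (f, g) = AMap H (f, g) \<cdot>\<^bsub>B\<^esub> conjugate (a', c)"
proof -
  have o: "a \<in> Obj A" "a' \<in> Obj A" "c \<in> Obj C" "c' \<in> Obj C"
    using f g L.A.Dom_Obj L.A.Cod_Obj L.T.B.Dom_Obj L.T.B.Cod_Obj by (auto simp: Hom_def)
  let ?b = "OMap H (a', c)" and ?b' = "OMap H' (a', c)" and ?s = "conjugate (a', c)"
  note b = L.H_Obj[OF o(2,3)] and b' = L'.H_Obj[OF o(2,3)]
  note ib = L.H.B.Id_Hom[OF b] and ib' = L.H.B.Id_Hom[OF b']
  note ia = L.A.Id_Hom[OF o(1)] and ia' = L.A.Id_Hom[OF o(2)]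
  note s = conjugate_Hom[OF o(2,3)] and s' = conjugate_Hom[OF o(1,4)]
  note e = L.counit_Hom[OF o(2,3)] and e' = L'.counit_Hom[OF o(2,3)]
  have "L.transpose a c' (conjugate (a, c') \<cdot>\<^bsub>B\<^esub> AMap H' (f, g))
      = (g \<cdot>\<^bsub>C\<^esub> \<epsilon>' a' c \<cdot>\<^bsub>C\<^esub> AMap T' (f, Id B ?b')) \<cdot>\<^bsub>C\<^esub> \<theta> (a, ?b')"
    by (simp add: transpose_conjugate_Comp[OF o(1,4) L'.H_Hom[OF f g]] L'.transpose_AMap[OF f g])
  also have "\<dots> = g \<cdot>\<^bsub>C\<^esub> \<epsilon>' a' c \<cdot>\<^bsub>C\<^esub> \<theta> (a', ?b') \<cdot>\<^bsub>C\<^esub> AMap T (f, Id B ?b')"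
    by (simp add: \<theta>_natural[OF f ib']
        L.T.B.Comp_assoc[OF \<theta>_Hom[OF o(1) b'] L.T.B.Comp_Hom[OF L'.T_Hom[OF f ib'] e'] g]
        L.T.B.Comp_assoc[OF \<theta>_Hom[OF o(1) b'] L'.T_Hom[OF f ib'] e'])
  also have "\<dots> = g \<cdot>\<^bsub>C\<^esub> L.transpose a' c ?s \<cdot>\<^bsub>C\<^esub> AMap T (f, Id B ?b')"
    by (simp add: transpose_conjugate[OF o(2,3)]
        L.T.B.Comp_assoc[OF L.T_Hom[OF f ib'] \<theta>_Hom[OF o(2) b'] e'])
  also have "\<dots> = g \<cdot>\<^bsub>C\<^esub> \<epsilon> a' c \<cdot>\<^bsub>C\<^esub> AMap T (Id A a', ?s) \<cdot>\<^bsub>C\<^esub> AMap T (f, Id B ?b')"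
    by (simp add: L.transpose_def L.T.B.Comp_assoc[OF L.T_Hom[OF f ib'] L.T_Hom[OF ia' s] e])
  also have "AMap T (Id A a', ?s) \<cdot>\<^bsub>C\<^esub> AMap T (f, Id B ?b')
      = AMap T (f, Id B ?b) \<cdot>\<^bsub>C\<^esub> AMap T (Id A a, ?s)"
    by (simp add: L.T_Comp[OF f ia' ib' s] L.T_Comp[OF ia f s ib] L.A.Id_left[OF f] L.A.Id_right[OF f]
        L.H.B.Id_left[OF s] L.H.B.Id_right[OF s])
  also have "g \<cdot>\<^bsub>C\<^esub> \<epsilon> a' c \<cdot>\<^bsub>C\<^esub> AMap T (f, Id B ?b) \<cdot>\<^bsub>C\<^esub> AMap T (Id A a, ?s)
      = L.transpose a c' (AMap H (f, g) \<cdot>\<^bsub>B\<^esub> ?s)"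
    by (simp add: L.transpose_Comp[OF o(1,4) s L.H_Hom[OF f g]] L.transpose_AMap[OF f g]
        L.T.B.Comp_assoc[OF L.T_Hom[OF ia s] L.T.B.Comp_Hom[OF L.T_Hom[OF f ib] e] g]
        L.T.B.Comp_assoc[OF L.T_Hom[OF ia s] L.T_Hom[OF f ib] e])
  finally show ?thesis
    by (intro L.transpose_inject[OF o(1,4) L.H.B.Comp_Hom[OF L'.H_Hom[OF f g] s']
          L.H.B.Comp_Hom[OF s L.H_Hom[OF f g]]])
qed

lemma nat_trans_conjugate: "nat_trans (op_cat A \<times>\<^sub>C C) B H' H conjugate"
proof (intro nat_trans.intro nat_trans_axioms.intro L.H.is_functor_axioms L'.H.is_functor_axioms)
  show "conjugate \<in> extensional (Obj (op_cat A \<times>\<^sub>C C))"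
    by (simp add: conj_l_def)
qed (auto simp: Hom_prod_cat Hom_op_cat intro: conjugate_Hom conjugate_natural)

text \<open>Conjugation for the dual adjunctions undoes conjugation: unfolded in the original categories,
  the left-hand side is \<open>\<epsilon> \<circ> T(a, \<sigma>) \<circ> T(a, \<eta>')\<close> with \<open>\<sigma>\<close> the conjugate of \<open>\<theta>\<close>, that is
  \<open>\<epsilon>' \<circ> \<theta> \<circ> T(a, \<eta>') = \<epsilon>' \<circ> T'(a, \<eta>') \<circ> \<theta>\<close>, and a triangle identity remains.\<close>

lemma dual_conjugate_conjugate:
  "conj_l A (op_cat C) (op_cat B) T \<epsilon> T' \<eta>' conjugate = \<theta>" (is "?k = \<theta>")
proof (rule extensionalityI)
  show "?k \<in> extensional (Obj (A \<times>\<^sub>C B))" by (simp add: conj_l_def)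
  show "\<theta> \<in> extensional (Obj (A \<times>\<^sub>C B))" by (rule \<theta>.extensional)
  fix x assume "x \<in> Obj (A \<times>\<^sub>C B)"
  then obtain a b where x: "x = (a, b)" and a: "a \<in> Obj A" and b: "b \<in> Obj B" by auto
  note c = L'.T_Obj[OF a b]
  note e = L'.unit_Hom[OF a b] and t = \<theta>_Hom[OF a b]
  have "?k x = L.transpose a (OMap T' (a, b)) (conjugate (a, OMap T' (a, b))) \<cdot>\<^bsub>C\<^esub> AMap T (Id A a, \<eta>' a b)"
    using a b by (simp add: x conj_l_def[of A "op_cat C"] L.transpose_def)
  also have "\<dots> = L'.transpose a (OMap T' (a, b)) (\<eta>' a b) \<cdot>\<^bsub>C\<^esub> \<theta> (a, b)"
    using transpose_conjugate_Comp[OF a c e] L.transpose_Comp[OF a c e conjugate_Hom[OF a c]] by simp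
  also have "\<dots> = \<theta> x"
    by (simp add: x L'.transpose_def L'.triangle_T[OF a b] L.T.B.Id_left[OF t])
  finally show "?k x = \<theta> x" .
qed

end

text \<open>With \<open>\<theta>\<close> an identity, the formula for the conjugate collapses to a triangle identity.\<close>

lemma conjugate_id:
  assumes "left_adjunction2 A B C T H \<epsilon> \<eta>"
  shows "conj_l A B C H \<eta> H \<epsilon> (id_nt (A \<times>\<^sub>C B) C T) = id_nt (op_cat A \<times>\<^sub>C C) B H"
proof (rule extensionalityI)
  interpret left_adjunction2 A B C T H \<epsilon> \<eta> by fact
  show "conj_l A B C H \<eta> H \<epsilon> (id_nt (A \<times>\<^sub>C B) C T) \<in> extensional (Obj (op_cat A \<times>\<^sub>C C))"
    by (simp add: conj_l_def)
  show "id_nt (op_cat A \<times>\<^sub>C C) B H \<in> extensional (Obj (op_cat A \<times>\<^sub>C C))" by (simp add: id_nt_def)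
  fix x assume "x \<in> Obj (op_cat A \<times>\<^sub>C C)"
  then obtain a c where x: "x = (a, c)" and a: "a \<in> Obj A" and c: "c \<in> Obj C" by auto
  note b = H_Obj[OF a c]
  note t = T_Obj[OF a b] and e = unit_Hom[OF a b]
  have "AMap H (Id A a, Id C (OMap T (a, OMap H (a, c))))
      = Id B (OMap H (a, OMap T (a, OMap H (a, c))))"
    using H.AMap_Id[of "(a, OMap T (a, OMap H (a, c)))"] a t by simp
  then show "conj_l A B C H \<eta> H \<epsilon> (id_nt (A \<times>\<^sub>C B) C T) x = id_nt (op_cat A \<times>\<^sub>C C) B H x"
    using a b c by (simp add: x conj_l_def id_nt_def H.B.Id_left[OF e] triangle_H)
qed

text \<open>Both sides have the transpose \<open>\<epsilon>'' \<circ> \<phi> \<circ> \<theta>\<close>.\<close>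

lemma conjugate_comp:
  assumes "conjugation A B C T H \<epsilon> \<eta> T' H' \<epsilon>' \<eta>' \<theta>"
    and "conjugation A B C T' H' \<epsilon>' \<eta>' T'' H'' \<epsilon>'' \<eta>'' \<phi>"
  shows "conj_l A B C H \<eta> H'' \<epsilon>'' (comp_nt (A \<times>\<^sub>C B) C \<phi> \<theta>)
    = comp_nt (op_cat A \<times>\<^sub>C C) B (conj_l A B C H \<eta> H' \<epsilon>' \<theta>) (conj_l A B C H' \<eta>' H'' \<epsilon>'' \<phi>)"
    (is "?l = ?r")
proof (rule extensionalityI)
  interpret c1: conjugation A B C T H \<epsilon> \<eta> T' H' \<epsilon>' \<eta>' \<theta> by fact
  interpret c2: conjugation A B C T' H' \<epsilon>' \<eta>' T'' H'' \<epsilon>'' \<eta>'' \<phi> by fact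
  interpret c3: conjugation A B C T H \<epsilon> \<eta> T'' H'' \<epsilon>'' \<eta>'' "comp_nt (A \<times>\<^sub>C B) C \<phi> \<theta>"
    by (intro conjugation.intro c1.L.left_adjunction2_axioms c2.L'.left_adjunction2_axioms
        nat_trans_comp[OF c1.\<theta>.nat_trans_axioms c2.\<theta>.nat_trans_axioms])
  show "?l \<in> extensional (Obj (op_cat A \<times>\<^sub>C C))" by (simp add: conj_l_def)
  show "?r \<in> extensional (Obj (op_cat A \<times>\<^sub>C C))" by (simp add: comp_nt_def)
  fix x assume "x \<in> Obj (op_cat A \<times>\<^sub>C C)"
  then obtain a c where x: "x = (a, c)" and a: "a \<in> Obj A" and c: "c \<in> Obj C" by auto
  note b = c2.L'.H_Obj[OF a c] and s = c2.conjugate_Hom[OF a c]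
  have "c1.L.transpose a c (?l (a, c)) = \<epsilon>'' a c \<cdot>\<^bsub>C\<^esub> \<phi> (a, OMap H'' (a, c)) \<cdot>\<^bsub>C\<^esub> \<theta> (a, OMap H'' (a, c))"
    using a b by (simp add: c3.transpose_conjugate[OF a c]) (simp add: comp_nt_def)
  also have "\<dots> = c1.L.transpose a c (c1.conjugate (a, c) \<cdot>\<^bsub>B\<^esub> c2.conjugate (a, c))"
    by (simp add: c1.transpose_conjugate_Comp[OF a c s] c2.transpose_conjugate[OF a c]
        c1.L.T.B.Comp_assoc[OF c1.\<theta>_Hom[OF a b] c2.\<theta>_Hom[OF a b] c2.L'.counit_Hom[OF a c]])
  finally have "?l (a, c) = c1.conjugate (a, c) \<cdot>\<^bsub>B\<^esub> c2.conjugate (a, c)"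
    by (rule c1.L.transpose_inject[OF a c c3.conjugate_Hom[OF a c]
          c1.L.H.B.Comp_Hom[OF s c1.conjugate_Hom[OF a c]]])
  then show "?l x = ?r x" using a c by (simp add: x comp_nt_def)
qed

section \<open>Invertibility of conjugates\<close>

lemma inverse_nt_conjugate:
  assumes "left_adjunction2 A B C T H \<epsilon> \<eta>" and "left_adjunction2 A B C T' H' \<epsilon>' \<eta>'"
    and "inverse_nt (A \<times>\<^sub>C B) C T T' \<theta> \<phi>"
  shows "inverse_nt (op_cat A \<times>\<^sub>C C) B H' H (conj_l A B C H \<eta> H' \<epsilon>' \<theta>) (conj_l A B C H' \<eta>' H \<epsilon> \<phi>)"
proof -
  have c: "conjugation A B C T H \<epsilon> \<eta> T' H' \<epsilon>' \<eta>' \<theta>" "conjugation A B C T' H' \<epsilon>' \<eta>' T H \<epsilon> \<eta> \<phi>"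
    using assms by (simp_all add: conjugation_def inverse_nt_def)
  have "comp_nt (A \<times>\<^sub>C B) C \<phi> \<theta> = id_nt (A \<times>\<^sub>C B) C T" "comp_nt (A \<times>\<^sub>C B) C \<theta> \<phi> = id_nt (A \<times>\<^sub>C B) C T'"
    using assms(3) by (simp_all add: inverse_nt_def)
  then show ?thesis
    using conjugation.nat_trans_conjugate[OF c(1)] conjugation.nat_trans_conjugate[OF c(2)]
      conjugate_comp[OF c(1) c(2)] conjugate_comp[OF c(2) c(1)]
      conjugate_id[OF assms(1)] conjugate_id[OF assms(2)]
    by (simp add: inverse_nt_def)
qed

text \<open>The preceding lemma, applied to the dual adjunctions and read in the original categories.\<close>

lemma inverse_nt_dual_conjugate:
  assumes "left_adjunction2 A B C T H \<epsilon> \<eta>" and "left_adjunction2 A B C T' H' \<epsilon>' \<eta>'"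
    and "inverse_nt (op_cat A \<times>\<^sub>C C) B H' H \<sigma> \<psi>"
  shows "inverse_nt (A \<times>\<^sub>C B) C T T'
    (conj_l A (op_cat C) (op_cat B) T \<epsilon> T' \<eta>' \<sigma>) (conj_l A (op_cat C) (op_cat B) T' \<epsilon>' T \<eta> \<psi>)"
proof -
  have "inverse_nt (A \<times>\<^sub>C op_cat C) (op_cat B) H H' \<sigma> \<psi>"
    using inverse_nt_op[OF assms(3)] by (simp add: op_cat_prod_cat)
  from inverse_nt_op[OF inverse_nt_conjugate[OF left_adjunction2_dual[OF assms(1)]
        left_adjunction2_dual[OF assms(2)] this]]
  show ?thesis by (simp add: op_cat_prod_cat)
qed


theorem corollary4p6:
  fixes A :: "('oa, 'ma) cat" and B :: "('ob, 'mb) cat" and C :: "('oc, 'mc) cat"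
    and T T' :: "('oa \<times> 'ob, 'ma \<times> 'mb, 'oc, 'mc) fctr"
    and H H' :: "('oa \<times> 'oc, 'ma \<times> 'mc, 'ob, 'mb) fctr"
    and \<epsilon> \<epsilon>' :: "'oa \<Rightarrow> 'oc \<Rightarrow> 'mc" and \<eta> \<eta>' :: "'oa \<Rightarrow> 'ob \<Rightarrow> 'mb"
    and \<theta> :: "'oa \<times> 'ob \<Rightarrow> 'mc"
  assumes "left_adjunction2 A B C T H \<epsilon> \<eta>"
    and "left_adjunction2 A B C T' H' \<epsilon>' \<eta>'"
    and "nat_trans (A \<times>\<^sub>C B) C T T' \<theta>"
  shows "nat_trans (op_cat A \<times>\<^sub>C C) B H' H (conj_l A B C H \<eta> H' \<epsilon>' \<theta>)
    \<and> ((\<exists>\<phi>. inverse_nt (A \<times>\<^sub>C B) C T T' \<theta> \<phi>)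
        \<longleftrightarrow> (\<exists>\<psi>. inverse_nt (op_cat A \<times>\<^sub>C C) B H' H (conj_l A B C H \<eta> H' \<epsilon>' \<theta>) \<psi>))
    \<and> (\<forall>\<phi>. inverse_nt (A \<times>\<^sub>C B) C T T' \<theta> \<phi> \<longrightarrow>
        (\<forall>\<psi>. inverse_nt (op_cat A \<times>\<^sub>C C) B H' H (conj_l A B C H \<eta> H' \<epsilon>' \<theta>) \<psi>
          \<longleftrightarrow> \<psi> = conj_l A B C H' \<eta>' H \<epsilon> \<phi>))"
proof -
  let ?j = "conj_l A B C H \<eta> H' \<epsilon>' \<theta>"
  interpret conjugation A B C T H \<epsilon> \<eta> T' H' \<epsilon>' \<eta>' \<theta>
    using assms by (rule conjugation.intro)
  have inverse_conjugate: "inverse_nt (op_cat A \<times>\<^sub>C C) B H' H ?j (conj_l A B C H' \<eta>' H \<epsilon> \<phi>)"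
    if "inverse_nt (A \<times>\<^sub>C B) C T T' \<theta> \<phi>" for \<phi>
    using inverse_nt_conjugate[OF assms(1,2) that] .
  moreover have "\<exists>\<phi>. inverse_nt (A \<times>\<^sub>C B) C T T' \<theta> \<phi>"
    if "inverse_nt (op_cat A \<times>\<^sub>C C) B H' H ?j \<psi>" for \<psi>
    using inverse_nt_dual_conjugate[OF assms(1,2) that] by (auto simp: dual_conjugate_conjugate)
  ultimately show ?thesis
    using nat_trans_conjugate inverse_nt_unique by blast
qed

end
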